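(* Let $q$ be a prime power (the characteristic of $\mathbb{F}_q$ is arbitrary) and let $m>0$ be an integer. Let $$\mathcal{T}_m=\{N_i,\,T_i \mid 1\le i\le m\}\cup\{U_{ij},\,H_{ij}\mid 1\le i<j\le m\},\qquad \mathcal{T}_m^{(2)}=\{N_i,\,T_i \mid 1\le i\le m\}\cup\{U_{ij}\mid 1\le i<j\le m\},$$ where $N_i=x_iy_i$, $T_i=x_i^{q-1}+y_i^{q-1}$, $U_{ij}=x_iy_j+x_jy_i$, $H_{ij}=x_ix_j^{q-2}+y_iy_j^{q-2}$. Then the set - $\mathcal{T}_m^{(2)}$, in case $q=2$; - $\mathcal{T}_m$, in case $q>2$; is a minimal separating set for the algebra of invariants $\mathbb{F}_q[V^m]^{\mathrm{O}_2^{+}(\mathbb{F}_q)}$.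
   Context: $V=\mathbb{F}_q^2$ (column vectors), and $v\in V$ is written $v=(v(1),v(2))$. For $\alpha\in\mathbb{F}_q^\times$ put $\sigma_\alpha=\begin{pmatrix}0&\alpha\\ \alpha^{-1}&0\end{pmatrix}$, $\tau_\alpha=\begin{pmatrix}\alpha&0\\0&\alpha^{-1}\end{pmatrix}$; then $\mathrm{O}_2^{+}(\mathbb{F}_q)=\{\sigma_\alpha,\tau_\alpha\mid\alpha\in\mathbb{F}_q^\times\}$, a subgroup of $\mathrm{GL}_2(\mathbb{F}_q)$. It acts diagonally on $V^m$: $g\cdot(v_1,\ldots,v_m)=(gv_1,\ldots,gv_m)$. The coordinate ring of $V^m$ is the polynomial ring $\mathbb{F}_q[V^m]=\mathbb{F}_q[x_1,\ldots,x_m,y_1,\ldots,y_m]$, where $x_i(\underline v)=v_i(1)$, $y_i(\underline v)=v_i(2)$ for $\underline v=(v_1,\ldots,v_m)\in V^m$. The group acts on $\mathbb{F}_q[V^m]$ by algebra automorphisms extending $(g\cdot f)(\underline v)=f(g^{-1}\cdot\underline v)$ on linear forms, i.e. $\sigma_1\cdot x_i=y_i$, $\sigma_1\cdot y_i=x_i$, $\tau_\alpha\cdot x_i=\alpha^{-1}x_i$, $\tau_\alpha\cdot y_i=\alpha y_i$; and $\mathbb{F}_q[V^m]^{\mathrm{O}_2^{+}(\mathbb{F}_q)}$ is the algebra of polynomials fixed by the group. Elements $u,v\in V^m$ are separated by a set $S$ of invariant polynomials if there is $f\in S$ with $f(u)\ne f(v)$. A subset $S$ of the invariant algebra is separating if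 any $u,v\in V^m$ that are separated by the whole invariant algebra are separated by $S$. A separating set is minimal if it is minimal with respect to inclusion among separating sets. *)

theory Defs
  imports "HOL-Analysis.Cartesian_Space" "HOL-Library.Poly_Mapping"
begin

text \<open>
  Polynomials are finitely supported functions from monomials (exponent vectors) to coefficients.
  The variable \<open>(i, k)\<close> is the coordinate function \<open>(v\<^sub>1, \<dots>, v\<^sub>m) \<mapsto> v\<^sub>i(k)\<close>, so that
  \<open>x\<^sub>i\<close> is the variable \<open>(i, 1)\<close> and \<open>y\<^sub>i\<close> is the variable \<open>(i, 2)\<close>.
\<close>

type_synonym var = "nat \<times> 2"
type_synonym 'a mpoly = "(var \<Rightarrow>\<^sub>0 nat) \<Rightarrow>\<^sub>0 'a"

definition Const :: "'a::zero \<Rightarrow> 'a mpoly" where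
  "Const c = Poly_Mapping.single 0 c"

definition Var :: "var \<Rightarrow> 'a::zero_neq_one mpoly" where
  "Var w = Poly_Mapping.single (Poly_Mapping.single w 1) 1"

abbreviation xvar :: "nat \<Rightarrow> 'a::zero_neq_one mpoly" where "xvar i \<equiv> Var (i, 1)"
abbreviation yvar :: "nat \<Rightarrow> 'a::zero_neq_one mpoly" where "yvar i \<equiv> Var (i, 2)"

definition poly_ring :: "nat \<Rightarrow> 'a::zero mpoly set" where
  "poly_ring m = {p. \<forall>t \<in> Poly_Mapping.keys p. Poly_Mapping.keys t \<subseteq> {1..m} \<times> UNIV}"

text \<open>
  For a ring homomorphism \<open>c\<close>, the ring homomorphism that extends \<open>c\<close> on coefficients and sends each variable \<open>w\<close> to \<open>\<phi> w\<close>;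
  it covers both evaluation at a point and substitution of polynomials.
\<close>

definition poly_hom :: "('a::zero \<Rightarrow> 'b::comm_ring_1) \<Rightarrow> (var \<Rightarrow> 'b) \<Rightarrow> 'a mpoly \<Rightarrow> 'b" where
  "poly_hom c \<phi> p =
     (\<Sum>t \<in> Poly_Mapping.keys p. c (Poly_Mapping.lookup p t) *
        (\<Prod>w \<in> Poly_Mapping.keys t. \<phi> w ^ Poly_Mapping.lookup t w))"

definition V_pow :: "nat \<Rightarrow> (nat \<Rightarrow> 'a^2) set" where
  "V_pow m = {1..m} \<rightarrow>\<^sub>E UNIV"

definition poly_eval :: "'a::field mpoly \<Rightarrow> (nat \<Rightarrow> 'a^2) \<Rightarrow> 'a" where
  "poly_eval f v = poly_hom id (\<lambda>(i, k). v i $ k) f"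

definition sigma_mat :: "'a::field \<Rightarrow> 'a^2^2" where
  "sigma_mat \<alpha> = vector [vector [0, \<alpha>], vector [inverse \<alpha>, 0]]"

definition tau_mat :: "'a::field \<Rightarrow> 'a^2^2" where
  "tau_mat \<alpha> = vector [vector [\<alpha>, 0], vector [0, inverse \<alpha>]]"

definition O2_plus :: "('a::field^2^2) set" where
  "O2_plus = {sigma_mat \<alpha> | \<alpha>. \<alpha> \<noteq> 0} \<union> {tau_mat \<alpha> | \<alpha>. \<alpha> \<noteq> 0}"

text \<open>
  The action of \<open>g\<close> by algebra automorphisms: the coordinate function \<open>(i, k)\<close> is sent to
  \<open>v \<mapsto> (g\<inverse> v\<^sub>i)(k)\<close>, written out as a linear form.
\<close>

definition act :: "'a::field^2^2 \<Rightarrow> 'a mpoly \<Rightarrow> 'a mpoly" where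
  "act g = poly_hom Const (\<lambda>(i, k). \<Sum>l\<in>UNIV. Const (matrix_inv g $ k $ l) * Var (i, l))"

definition invariants :: "nat \<Rightarrow> ('a::field^2^2) set \<Rightarrow> 'a mpoly set" where
  "invariants m G = {f \<in> poly_ring m. \<forall>g \<in> G. act g f = f}"

definition separated_by :: "'a::field mpoly set \<Rightarrow> (nat \<Rightarrow> 'a^2) \<Rightarrow> (nat \<Rightarrow> 'a^2) \<Rightarrow> bool" where
  "separated_by S u v \<longleftrightarrow> (\<exists>f \<in> S. poly_eval f u \<noteq> poly_eval f v)"

definition separating :: "nat \<Rightarrow> ('a::field^2^2) set \<Rightarrow> 'a mpoly set \<Rightarrow> bool" where
  "separating m G S \<longleftrightarrow> S \<subseteq> invariants m G \<and>
     (\<forall>u \<in> V_pow m. \<forall>v \<in> V_pow m.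
        separated_by (invariants m G) u v \<longrightarrow> separated_by S u v)"

definition minimal_separating :: "nat \<Rightarrow> ('a::field^2^2) set \<Rightarrow> 'a mpoly set \<Rightarrow> bool" where
  "minimal_separating m G S \<longleftrightarrow> separating m G S \<and> (\<forall>S'. S' \<subset> S \<longrightarrow> \<not> separating m G S')"

text \<open>The order \<open>q\<close> of the finite field is \<open>CARD('a)\<close>.\<close>

definition N_poly :: "nat \<Rightarrow> 'a::field mpoly" where
  "N_poly i = xvar i * yvar i"

definition T_poly :: "nat \<Rightarrow> 'a::{field,finite} mpoly" where
  "T_poly i = xvar i ^ (CARD('a) - 1) + yvar i ^ (CARD('a) - 1)"

definition U_poly :: "nat \<Rightarrow> nat \<Rightarrow> 'a::field mpoly" where
  "U_poly i j = xvar i * yvar j + xvar j * yvar i"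

definition H_poly :: "nat \<Rightarrow> nat \<Rightarrow> 'a::{field,finite} mpoly" where
  "H_poly i j = xvar i * xvar j ^ (CARD('a) - 2) + yvar i * yvar j ^ (CARD('a) - 2)"

definition T_set :: "nat \<Rightarrow> 'a::{field,finite} mpoly set" where
  "T_set m = {N_poly i | i. 1 \<le> i \<and> i \<le> m} \<union> {T_poly i | i. 1 \<le> i \<and> i \<le> m} \<union>
     {U_poly i j | i j. 1 \<le> i \<and> i < j \<and> j \<le> m} \<union> {H_poly i j | i j. 1 \<le> i \<and> i < j \<and> j \<le> m}"

definition T2_set :: "nat \<Rightarrow> 'a::{field,finite} mpoly set" where
  "T2_set m = {N_poly i | i. 1 \<le> i \<and> i \<le> m} \<union> {T_poly i | i. 1 \<le> i \<and> i \<le> m} \<union>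
     {U_poly i j | i j. 1 \<le> i \<and> i < j \<and> j \<le> m}"

end

theory Submission imports Defs begin

text \<open>
  Two points on which all the given invariants agree lie in one orbit, so no invariant tells them apart.
  If some \<open>N\<^sub>i\<close> is nonzero, the \<open>i\<close>-th vector can be moved to its image and has a stabilizer of order
  at most two; \<open>N\<close> and \<open>U\<close> determine the other vectors up to this stabilizer. Otherwise every vector
  lies on a coordinate axis: \<open>T\<close> detects the zero vectors, \<open>U\<close> detects whether two nonzero vectors
  lie on the same axis, and then \<open>H\<close> (same axis) or \<open>U\<close> (different axes) gives the scalars.
  Minimality is witnessed, for each generator, by a pair of points with at most two nonzero vectors.
\<close>

section \<open>Substitution homomorphisms\<close>

text \<open>Ring homomorphisms, isolated so that one treatment of \<open>poly_hom\<close> serves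
  both evaluation (coefficients mapped by \<open>id\<close>) and substitution (coefficients mapped
  by \<open>Const\<close>).\<close>

locale coeff_hom =
  fixes c :: "'a::comm_ring_1 \<Rightarrow> 'b::comm_ring_1"
  assumes zero: "c 0 = 0" and one: "c 1 = 1"
    and add: "c (a + b) = c a + c b" and mult: "c (a * b) = c a * c b"
begin

lemma power: "c (a ^ n) = c a ^ n"
  by (induction n) (simp_all add: one mult)

lemma sum: "c (sum f A) = (\<Sum>x\<in>A. c (f x))"
  by (induction A rule: infinite_finite_induct) (simp_all add: zero add)

lemma prod: "c (prod f A) = (\<Prod>x\<in>A. c (f x))"
  by (induction A rule: infinite_finite_induct) (simp_all add: one mult)

end

definition monom_hom :: "(var \<Rightarrow> 'b::comm_ring_1) \<Rightarrow> (var \<Rightarrow>\<^sub>0 nat) \<Rightarrow> 'b" where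
  "monom_hom \<phi> t = (\<Prod>w \<in> Poly_Mapping.keys t. \<phi> w ^ Poly_Mapping.lookup t w)"

lemma monom_hom_superset:
  assumes "finite A" "Poly_Mapping.keys t \<subseteq> A"
  shows "monom_hom \<phi> t = (\<Prod>w\<in>A. \<phi> w ^ Poly_Mapping.lookup t w)"
  unfolding monom_hom_def using assms
  by (intro prod.mono_neutral_left) (auto simp: in_keys_iff)

lemma monom_hom_zero: "monom_hom \<phi> 0 = 1"
  by (simp add: monom_hom_def)

lemma monom_hom_add: "monom_hom \<phi> (s + t) = monom_hom \<phi> s * monom_hom \<phi> t"
proof -
  let ?A = "Poly_Mapping.keys s \<union> Poly_Mapping.keys t"
  have "monom_hom \<phi> u = (\<Prod>w\<in>?A. \<phi> w ^ Poly_Mapping.lookup u w)" if "u \<in> {s, t, s + t}" for u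
    using that keys_add[of s t] by (intro monom_hom_superset) auto
  then show ?thesis
    by (simp add: lookup_add power_add prod.distrib)
qed

lemma poly_hom_monom_hom:
  "poly_hom c \<phi> p = (\<Sum>t \<in> Poly_Mapping.keys p. c (Poly_Mapping.lookup p t) * monom_hom \<phi> t)"
  by (simp add: poly_hom_def monom_hom_def)

text \<open>Each inserted key is new, which turns the update into a sum.\<close>

lemma poly_mapping_single_add_induct [case_names zero add]:
  fixes p :: "'k \<Rightarrow>\<^sub>0 'a::comm_monoid_add"
  assumes "P 0"
    and step: "\<And>f k a. P f \<Longrightarrow> P (f + Poly_Mapping.single k a)"
  shows "P p"
proof (induction p rule: update_induct)
  case (update f k a)
  have "Poly_Mapping.update k a f = f + Poly_Mapping.single k a"
    using update(1)
    by (intro poly_mapping_eqI) (auto simp: lookup_update lookup_add lookup_single in_keys_iff)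
  with step[OF update(3)] show ?case by simp
qed (fact assms(1))

context coeff_hom
begin

lemma poly_hom_zero: "poly_hom c \<phi> 0 = 0"
  by (simp add: poly_hom_def)

lemma poly_hom_add: "poly_hom c \<phi> (p + q) = poly_hom c \<phi> p + poly_hom c \<phi> q"
  unfolding poly_hom_monom_hom
  by (rule setsum_keys_plus_distrib) (simp_all add: zero add algebra_simps)

lemma poly_hom_single: "poly_hom c \<phi> (Poly_Mapping.single t a) = c a * monom_hom \<phi> t"
  by (simp add: poly_hom_monom_hom zero)

lemma poly_hom_Const: "poly_hom c \<phi> (Const a) = c a"
  by (simp add: Const_def poly_hom_single monom_hom_zero)

lemma poly_hom_Var: "poly_hom c \<phi> (Var w) = \<phi> w"
  by (simp add: Var_def poly_hom_single one) (simp add: monom_hom_def)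

text \<open>Distributivity reduces both factors to single terms, whose exponents add.\<close>

lemma poly_hom_mult: "poly_hom c \<phi> (p * q) = poly_hom c \<phi> p * poly_hom c \<phi> q"
proof (induction p rule: poly_mapping_single_add_induct)
  case (add p s a)
  have "poly_hom c \<phi> (Poly_Mapping.single s a * q) = c a * monom_hom \<phi> s * poly_hom c \<phi> q"
    by (induction q rule: poly_mapping_single_add_induct)
      (simp_all add: poly_hom_zero distrib_left poly_hom_add mult_single poly_hom_single
        monom_hom_add mult)
  with add.IH show ?case
    by (simp add: distrib_right poly_hom_add poly_hom_single)
qed (simp add: poly_hom_zero)

lemma poly_hom_one: "poly_hom c \<phi> 1 = 1"
  using poly_hom_Const[of \<phi> 1] by (simp add: Const_def one)

lemma coeff_hom_poly_hom: "coeff_hom (poly_hom c \<phi>)"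
  by unfold_locales (simp_all add: poly_hom_zero poly_hom_one poly_hom_add poly_hom_mult)

lemma poly_hom_comp: "c (poly_hom d \<psi> p) = poly_hom (c \<circ> d) (c \<circ> \<psi>) p"
  by (simp add: poly_hom_def sum prod mult power)

end

section \<open>Evaluation and the group action as substitutions\<close>

interpretation id_hom: coeff_hom "id :: 'a::comm_ring_1 \<Rightarrow> 'a"
  by unfold_locales simp_all

interpretation Const_hom: coeff_hom "Const :: 'a::comm_ring_1 \<Rightarrow> 'a mpoly"
  by unfold_locales (simp_all add: Const_def single_add mult_single)

interpretation eval_hom: coeff_hom "\<lambda>f. poly_eval f v" for v :: "nat \<Rightarrow> 'a::field^2"
  unfolding poly_eval_def by (rule id_hom.coeff_hom_poly_hom)

interpretation act_hom: coeff_hom "act g" for g :: "'a::field^2^2"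
  unfolding act_def by (rule Const_hom.coeff_hom_poly_hom)

lemma eval_Const [simp]: "poly_eval (Const a) v = a"
  by (simp add: poly_eval_def id_hom.poly_hom_Const)

lemma eval_Var [simp]: "poly_eval (Var (i, k)) v = v i $ k"
  by (simp add: poly_eval_def id_hom.poly_hom_Var)

lemma act_Var: "act g (Var (i, k)) = (\<Sum>l\<in>UNIV. Const (matrix_inv g $ k $ l) * Var (i, l))"
  by (simp add: act_def Const_hom.poly_hom_Var)

text \<open>Evaluation after substitution is again a substitution, so it suffices to compare both
  sides on constants and variables.\<close>

lemma eval_act: "poly_eval (act g f) v = poly_eval f (\<lambda>i. matrix_inv g *v v i)"
proof -
  have "(\<lambda>f. poly_eval f v) \<circ> (\<lambda>(i, k). \<Sum>l\<in>UNIV. Const (matrix_inv g $ k $ l) * Var (i, l))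
      = (\<lambda>(i, k). (matrix_inv g *v v i) $ k)"
    by (auto simp: fun_eq_iff eval_hom.sum eval_hom.mult matrix_vector_mult_def)
  moreover have "(\<lambda>f. poly_eval f v) \<circ> Const = id"
    by (simp add: fun_eq_iff)
  ultimately show ?thesis
    unfolding act_def eval_hom.poly_hom_comp by (simp add: poly_eval_def)
qed

text \<open>Points of \<open>V_pow m\<close> are \<open>undefined\<close> outside
  \<open>{1..m}\<close>, a condition that applying a matrix at every index need not
  preserve.\<close>

lemma eval_cong:
  assumes "f \<in> poly_ring m" "\<And>i. i \<in> {1..m} \<Longrightarrow> u i = v i"
  shows "poly_eval f u = poly_eval f v"
  unfolding poly_eval_def poly_hom_def
proof (intro sum.cong refl arg_cong2[where f = "(*)"] prod.cong)
  fix t w assume "t \<in> Poly_Mapping.keys f" "w \<in> Poly_Mapping.keys t"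
  with assms(1) have "w \<in> {1..m} \<times> UNIV"
    unfolding poly_ring_def by blast
  with assms(2) show "(case w of (i, k) \<Rightarrow> u i $ k) ^ Poly_Mapping.lookup t w
      = (case w of (i, k) \<Rightarrow> v i $ k) ^ Poly_Mapping.lookup t w"
    by auto
qed

lemma poly_ring_add: "p \<in> poly_ring m \<Longrightarrow> q \<in> poly_ring m \<Longrightarrow> p + q \<in> poly_ring m"
  using keys_add[of p q] by (auto simp: poly_ring_def)

lemma poly_ring_mult:
  assumes "p \<in> poly_ring m" "q \<in> poly_ring m"
  shows "p * q \<in> poly_ring m"
proof -
  have "Poly_Mapping.keys t \<subseteq> {1..m} \<times> UNIV" if t: "t \<in> Poly_Mapping.keys (p * q)" for t
  proof -
    obtain a b where "t = a + b" "a \<in> Poly_Mapping.keys p" "b \<in> Poly_Mapping.keys q"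
      using t keys_mult[of p q] by blast
    with assms keys_add[of a b] show ?thesis
      unfolding poly_ring_def by blast
  qed
  then show ?thesis by (simp add: poly_ring_def)
qed

lemma poly_ring_power: "(p :: 'a::comm_ring_1 mpoly) \<in> poly_ring m \<Longrightarrow> p ^ n \<in> poly_ring m"
  by (induction n) (simp_all add: poly_ring_mult, simp add: poly_ring_def)

lemma poly_ring_Var: "i \<in> {1..m} \<Longrightarrow> Var (i, k) \<in> poly_ring m"
  by (auto simp: poly_ring_def Var_def)

section \<open>The group and its invariants\<close>

lemma matrix_inv_eqI:
  fixes A B :: "'a::semiring_1^'n^'n"
  assumes "A ** B = mat 1" "B ** A = mat 1"
  shows "matrix_inv A = B"
  unfolding matrix_inv_def
proof (rule some_equality)
  fix C assume "A ** C = mat 1 \<and> C ** A = mat 1"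
  then show "C = B"
    by (metis assms(1) matrix_mul_assoc matrix_mul_lid matrix_mul_rid)
qed (use assms in simp)

lemma matrix_inv_sigma:
  assumes "\<alpha> \<noteq> 0" shows "matrix_inv (sigma_mat \<alpha>) = sigma_mat \<alpha>"
  by (rule matrix_inv_eqI)
    (use assms in \<open>simp_all add: sigma_mat_def vec_eq_iff matrix_matrix_mult_def mat_def forall_2 sum_2\<close>)

lemma matrix_inv_tau:
  assumes "\<alpha> \<noteq> 0" shows "matrix_inv (tau_mat \<alpha>) = tau_mat (inverse \<alpha>)"
  by (rule matrix_inv_eqI)
    (use assms in \<open>simp_all add: tau_mat_def vec_eq_iff matrix_matrix_mult_def mat_def forall_2 sum_2\<close>)

lemma sigma_mult: "sigma_mat \<alpha> *v v = vector [\<alpha> * v $ 2, inverse \<alpha> * v $ 1]"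
  by (simp add: sigma_mat_def vec_eq_iff matrix_vector_mult_def forall_2 sum_2)

lemma tau_mult: "tau_mat \<alpha> *v v = vector [\<alpha> * v $ 1, inverse \<alpha> * v $ 2]"
  by (simp add: tau_mat_def vec_eq_iff matrix_vector_mult_def forall_2 sum_2)

lemma act_sigma_Var:
  assumes "\<alpha> \<noteq> 0"
  shows "act (sigma_mat \<alpha>) (xvar i) = Const \<alpha> * yvar i"
    and "act (sigma_mat \<alpha>) (yvar i) = Const (inverse \<alpha>) * xvar i"
  using assms by (simp_all add: act_Var matrix_inv_sigma sum_2) (simp_all add: sigma_mat_def Const_hom.zero)

lemma act_tau_Var:
  assumes "\<alpha> \<noteq> 0"
  shows "act (tau_mat \<alpha>) (xvar i) = Const (inverse \<alpha>) * xvar i"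
    and "act (tau_mat \<alpha>) (yvar i) = Const \<alpha> * yvar i"
  using assms by (simp_all add: act_Var matrix_inv_tau sum_2) (simp_all add: tau_mat_def Const_hom.zero)

lemma invariant_evalI:
  assumes f: "f \<in> invariants m G" and g: "g \<in> G"
    and "\<And>i. i \<in> {1..m} \<Longrightarrow> v i = matrix_inv g *v u i"
  shows "poly_eval f u = poly_eval f v"
proof -
  have "poly_eval f u = poly_eval (act g f) u"
    using f g by (simp add: invariants_def)
  also have "\<dots> = poly_eval f v"
    unfolding eval_act using f assms(3) by (intro eval_cong[of _ m]) (auto simp: invariants_def)
  finally show ?thesis .
qed

section \<open>Powers in a finite field and the generators\<close>

lemma CARD_field_ge_2: "CARD('a::{field,finite}) \<ge> 2"
  using card_mono[of UNIV "{0, 1 :: 'a}"] by simp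

text \<open>Multiplication by a nonzero \<open>x\<close> permutes the nonzero elements, so their
  product cancels.\<close>

lemma power_card_minus_1:
  fixes x :: "'a::{field,finite}"
  shows "x ^ (CARD('a) - 1) = (if x = 0 then 0 else 1)"
proof (cases "x = 0")
  case False
  have "(\<Prod>y\<in>UNIV-{0}. x * y) = (\<Prod>y\<in>UNIV-{0::'a}. y)"
    by (rule prod.reindex_bij_witness[of _ "\<lambda>y. y / x" "\<lambda>y. x * y"]) (use False in auto)
  then have "x ^ (CARD('a) - 1) * \<Prod>(UNIV-{0::'a}) = \<Prod>(UNIV-{0::'a})"
    by (simp add: prod.distrib)
  then show ?thesis using False by simp
qed (use CARD_field_ge_2[where 'a='a] in simp)

text \<open>For q > 2 the exponent is positive, so the power at 0 is 0, in agreement with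
  \<open>inverse 0 = 0\<close>; for q = 2 it would be 1.\<close>

lemma power_card_minus_2:
  fixes x :: "'a::{field,finite}"
  assumes "CARD('a) > 2"
  shows "x ^ (CARD('a) - 2) = inverse x"
proof (cases "x = 0")
  case False
  have "x * x ^ (CARD('a) - 2) = x ^ (CARD('a) - 1)"
    using assms by (simp flip: power_Suc) (simp add: Suc_diff_Suc numeral_2_eq_2)
  then show ?thesis
    using False by (simp add: power_card_minus_1 field_simps del: One_nat_def)
qed (use assms in simp)

lemma eval_generators:
  "poly_eval (N_poly i) v = v i $ 1 * v i $ 2"
  "poly_eval (U_poly i j) v = v i $ 1 * v j $ 2 + v j $ 1 * v i $ 2"
  by (simp_all add: N_poly_def U_poly_def eval_hom.add eval_hom.mult)

lemma eval_T:
  fixes v :: "nat \<Rightarrow> 'a::{field,finite}^2"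
  shows "poly_eval (T_poly i) v = (if v i $ 1 = 0 then 0 else 1) + (if v i $ 2 = 0 then 0 else 1)"
  by (simp add: T_poly_def eval_hom.add eval_hom.power power_card_minus_1 del: One_nat_def)

lemma eval_H:
  fixes v :: "nat \<Rightarrow> 'a::{field,finite}^2"
  assumes "CARD('a) > 2"
  shows "poly_eval (H_poly i j) v = v i $ 1 * inverse (v j $ 1) + v i $ 2 * inverse (v j $ 2)"
  using assms by (simp add: H_poly_def eval_hom.add eval_hom.mult eval_hom.power power_card_minus_2)

lemma generators_in_poly_ring:
  assumes "i \<in> {1..m}" "j \<in> {1..m}"
  shows "N_poly i \<in> poly_ring m" "T_poly i \<in> poly_ring m"
    "U_poly i j \<in> poly_ring m" "H_poly i j \<in> poly_ring m"
  unfolding N_poly_def T_poly_def U_poly_def H_poly_def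
  by (intro poly_ring_add poly_ring_mult poly_ring_power poly_ring_Var assms)+

text \<open>Under \<open>tau_mat \<alpha>\<close> the monomials of the generators have weight 0
  (\<open>N\<close>, \<open>U\<close>) or, up to sign, q - 1 (\<open>T\<close>, \<open>H\<close>),
  and the power q - 1 of \<alpha> is 1.\<close>

lemma torus_weights_cancel:
  fixes \<alpha> :: "'a::{field,finite}"
  assumes "\<alpha> \<noteq> 0"
  shows "(Const \<alpha> * p) * (Const (inverse \<alpha>) * q) = p * q"
    and "(Const (inverse \<alpha>) * p) * (Const \<alpha> * q) = p * q"
    and "(Const \<alpha> * p) ^ (CARD('a) - 1) = p ^ (CARD('a) - 1)"
    and "CARD('a) > 2 \<Longrightarrow> (Const \<alpha> * p) * (Const \<alpha> * q) ^ (CARD('a) - 2) = p * q ^ (CARD('a) - 2)"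
proof -
  have *: "Const a * p * (Const b * q) = Const (a * b) * (p * q)" for a b :: 'a and p q
    by (simp add: Const_hom.mult mult_ac)
  have C: "Const \<alpha> ^ n = Const (\<alpha> ^ n)" for n
    by (simp add: Const_hom.power)
  show "(Const \<alpha> * p) * (Const (inverse \<alpha>) * q) = p * q"
    "(Const (inverse \<alpha>) * p) * (Const \<alpha> * q) = p * q"
    "(Const \<alpha> * p) ^ (CARD('a) - 1) = p ^ (CARD('a) - 1)"
    using assms by (simp_all only: * C power_mult_distrib power_card_minus_1) (simp_all add: Const_hom.one)
  show "(Const \<alpha> * p) * (Const \<alpha> * q) ^ (CARD('a) - 2) = p * q ^ (CARD('a) - 2)" if "CARD('a) > 2"
    using assms that by (simp only: * C power_mult_distrib power_card_minus_2) (simp add: Const_hom.one)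
qed

text \<open>Once the scalars cancel, \<open>tau_mat\<close> fixes every monomial of a generator, and
  \<open>sigma_mat\<close> exchanges x and y, which only permutes these monomials.\<close>

lemma generators_invariant:
  assumes "i \<in> {1..m}" "j \<in> {1..m}"
  shows "N_poly i \<in> invariants m (O2_plus :: ('a::{field,finite}^2^2) set)"
    "T_poly i \<in> invariants m (O2_plus :: ('a^2^2) set)"
    "U_poly i j \<in> invariants m (O2_plus :: ('a^2^2) set)"
    "CARD('a) > 2 \<Longrightarrow> H_poly i j \<in> invariants m (O2_plus :: ('a^2^2) set)"
proof -
  note defs = N_poly_def T_poly_def U_poly_def H_poly_def
  have "act (sigma_mat \<alpha>) (N_poly i) = N_poly i \<and> act (tau_mat \<alpha>) (N_poly i) = N_poly i
    \<and> act (sigma_mat \<alpha>) (T_poly i) = T_poly i \<and> act (tau_mat \<alpha>) (T_poly i) = T_poly i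
    \<and> act (sigma_mat \<alpha>) (U_poly i j) = U_poly i j \<and> act (tau_mat \<alpha>) (U_poly i j) = U_poly i j
    \<and> (CARD('a) > 2 \<longrightarrow> act (sigma_mat \<alpha>) (H_poly i j) = H_poly i j
        \<and> act (tau_mat \<alpha>) (H_poly i j) = H_poly i j)"
    if "\<alpha> \<noteq> 0" for \<alpha> :: 'a
    using that
    by (simp add: defs act_hom.add act_hom.mult act_hom.power act_sigma_Var act_tau_Var
        torus_weights_cancel add.commute mult.commute[of "yvar _" "xvar _"]
        del: One_nat_def)
  then show "N_poly i \<in> invariants m (O2_plus :: ('a^2^2) set)"
    "T_poly i \<in> invariants m (O2_plus :: ('a^2^2) set)"
    "U_poly i j \<in> invariants m (O2_plus :: ('a^2^2) set)"
    "CARD('a) > 2 \<Longrightarrow> H_poly i j \<in> invariants m (O2_plus :: ('a^2^2) set)"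
    using generators_in_poly_ring[OF assms]
    by (auto simp: invariants_def O2_plus_def)
qed


section \<open>Separation of orbits\<close>

text \<open>
  The points \<open>(a i, b i)\<close> and \<open>(c i, d i)\<close> have equal values of \<open>N\<close>, \<open>T\<close>, \<open>U\<close> and \<open>H\<close>.
  In \<open>H\<close> the power \<open>x ^ (q - 2)\<close> is \<open>inverse x\<close>, also at \<open>x = 0\<close> because \<open>inverse 0 = 0\<close>.
\<close>

locale matching_pair =
  fixes I :: "nat set" and a b c d :: "nat \<Rightarrow> 'a::field"
  assumes N: "i \<in> I \<Longrightarrow> a i * b i = c i * d i"
    and T: "i \<in> I \<Longrightarrow> a i = 0 \<and> b i = 0 \<longleftrightarrow> c i = 0 \<and> d i = 0"
    and U: "i \<in> I \<Longrightarrow> j \<in> I \<Longrightarrow> a i * b j + a j * b i = c i * d j + c j * d i"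
    and H: "i \<in> I \<Longrightarrow> j \<in> I \<Longrightarrow> i < j \<Longrightarrow>
      a i * inverse (a j) + b i * inverse (b j) = c i * inverse (c j) + d i * inverse (d j)"
begin

text \<open>The orbit relation in scalars: a single \<open>tau_mat k\<close> carries every vector (a
  i, b i) to (c i, d i). The companion \<open>swap_rel\<close> expresses the same for
  \<open>sigma_mat k\<close>.\<close>

definition diag_rel :: bool where
  "diag_rel \<longleftrightarrow> (\<exists>k. k \<noteq> 0 \<and> (\<forall>i\<in>I. c i = k * a i \<and> d i = inverse k * b i))"

definition swap_rel :: bool where
  "swap_rel \<longleftrightarrow> (\<exists>k. k \<noteq> 0 \<and> (\<forall>i\<in>I. c i = k * b i \<and> d i = inverse k * a i))"

text \<open>For an index \<open>i\<close> with \<open>a i * b i \<noteq> 0\<close>, the polynomials \<open>N\<close> and \<open>U\<close> alone pin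
  down every other vector up to the reflection fixing the \<open>i\<close>-th one; the choice between the two
  candidates is the same for all indices because of the \<open>U\<close> between them.\<close>

lemma anisotropic:
  assumes i: "i \<in> I" and nz: "a i * b i \<noteq> 0"
  shows "diag_rel \<or> swap_rel"
proof -
  \<comment> \<open>Both \<open>tau_mat k\<close> and \<open>sigma_mat k'\<close> carry the
    \<open>i\<close>-th vector to its image.\<close>
  define k k' where "k = c i / a i" and "k' = c i / b i"
  have nz': "a i \<noteq> 0" "b i \<noteq> 0" "c i \<noteq> 0" "d i \<noteq> 0"
    using nz N[OF i] by auto
  then have k: "k \<noteq> 0" "k' \<noteq> 0" "k * a i = c i" "k' * b i = c i"
    by (simp_all add: k_def k'_def)
  have inv: "inverse k * b i = d i" "inverse k' * a i = d i"
    using nz' N[OF i] by (simp_all add: k_def k'_def field_simps)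
  \<comment> \<open>Once \<open>c j\<close> is known, the \<open>U\<close> relation is linear in
    \<open>d j\<close> with nonzero coefficient \<open>c i\<close>.\<close>
  have P: "d j = inverse k * b j" if "j \<in> I" "c j = k * a j" for j
  proof -
    have "c i * d j + c j * d i = a i * b j + a j * b i"
      using U[OF i that(1)] by simp
    moreover have "c j * d i = a j * b i"
      using that(2) inv(1) k(1) by (simp flip: inv(1))
    ultimately have "c i * d j = a i * b j"
      by simp
    then show ?thesis
      using nz' k(1) by (simp add: k_def field_simps)
  qed
  have Q: "d j = inverse k' * a j" if "j \<in> I" "c j = k' * b j" for j
  proof -
    have "c i * d j + c j * d i = a i * b j + a j * b i"
      using U[OF i that(1)] by simp
    moreover have "c j * d i = a i * b j"
      using that(2) k(2) by (simp flip: inv(2))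
    ultimately have "c i * d j = b i * a j"
      by (simp add: mult.commute)
    then show ?thesis
      using nz' k(2) by (simp add: k'_def field_simps)
  qed
  have PQ: "c j = k * a j \<or> c j = k' * b j" if "j \<in> I" for j
  proof -
    \<comment> \<open>The \<open>U\<close> relation times \<open>c j\<close>, with
      \<open>c j * d j\<close> replaced by \<open>a j * b j\<close>, is a quadratic equation for
      \<open>c j\<close> whose roots are these two candidates.\<close>
    have "d i * ((c j - k * a j) * (c j - k' * b j))
        = c j * (d i * c j - (d i * k) * a j - (d i * k') * b j) + (d i * k) * k' * (a j * b j)"
      by (simp add: algebra_simps)
    also have "d i * k = b i"
      using k(1) by (simp flip: inv(1))
    also have "d i * k' = a i"
      using k(2) by (simp flip: inv(2))
    also have "b i * k' = c i"
      using k(4) by (simp add: mult.commute)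
    also have "c j * (d i * c j - b i * a j - a i * b j) + c i * (a j * b j) = 0"
      using U[OF i that] N[OF that] by algebra
    finally show ?thesis using nz' by auto
  qed
  show ?thesis
  proof (rule ccontr)
    assume "\<not> ?thesis"
    then obtain j l where j: "j \<in> I" "c j \<noteq> k * a j" and l: "l \<in> I" "c l \<noteq> k' * b l"
      using P Q k(1,2) unfolding diag_rel_def swap_rel_def by blast
    have j': "c j = k' * b j" "d j = inverse k' * a j"
      and l': "c l = k * a l" "d l = inverse k * b l"
      using PQ[OF j(1)] PQ[OF l(1)] P Q j l by auto
    have "a j * b l + a l * b j = k' * b j * (inverse k * b l) + k * a l * (inverse k' * a j)"
      using U[OF j(1) l(1)] j' l' by simp
    \<comment> \<open>Index \<open>j\<close> admits only the swapped candidate and \<open>l\<close>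
      only the diagonal one, so neither factor can vanish.\<close>
    then have "(k * a j - k' * b j) * (k * a l - k' * b l) = 0"
      using k(1,2) by (simp add: field_simps)
    then show False
      using j j' l l' by auto
  qed
qed

text \<open>Vector \<open>i\<close> and its image lie on the first axis, so \<open>U\<close> with
  index \<open>i\<close> fixes all second coordinates. A first coordinate is then settled by
  \<open>N\<close> off this axis, by \<open>T\<close> at zero vectors and by the ratio
  \<open>H\<close> on the axis.\<close>

lemma isotropic_aligned:
  assumes i: "i \<in> I" and iso: "\<And>j. j \<in> I \<Longrightarrow> a j * b j = 0"
    and nz: "a i \<noteq> 0" "c i \<noteq> 0"
  shows diag_rel
proof -
  define k where "k = c i / a i"
  have k: "k \<noteq> 0" "c i = k * a i"
    using nz by (simp_all add: k_def)
  have bd: "b i = 0" "d i = 0"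
    using iso[OF i] N[OF i] nz by auto
  have "c j = k * a j \<and> d j = inverse k * b j" if j: "j \<in> I" for j
  proof
    have "c i * d j = a i * b j"
      using U[OF i j] bd by simp
    then show d: "d j = inverse k * b j"
      using nz by (simp add: k_def field_simps)
    consider "b j \<noteq> 0" | "b j = 0" "a j = 0" | "b j = 0" "a j \<noteq> 0"
      by blast
    then show "c j = k * a j"
    proof cases
      case 1
      then show ?thesis using iso[OF j] N[OF j] d k by auto
    next
      case 2
      then show ?thesis using T[OF j] by auto
    next
      case 3
      then have "c j \<noteq> 0" "d j = 0"
        using T[OF j] d by auto
      \<comment> \<open>\<open>H\<close> is given only with the smaller index first, but a ratio and
        its reciprocal carry the same information; the second summands vanish.\<close>
      with 3 k nz bd show ?thesis
        using H[OF i j] H[OF j i] by (cases i j rule: linorder_cases) (simp_all add: field_simps)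
    qed
  qed
  then show ?thesis
    using k unfolding diag_rel_def by blast
qed

lemma same_orbit: "diag_rel \<or> swap_rel"
proof (cases "\<forall>i\<in>I. a i * b i = 0")
  case False
  then show ?thesis using anisotropic by blast
next
  case iso: True
  show ?thesis
  proof (cases "\<forall>i\<in>I. a i = 0 \<and> b i = 0")
    case True
    then have "diag_rel"
      using T unfolding diag_rel_def by (intro exI[of _ 1]) auto
    then show ?thesis ..
  next
    case False
    then obtain i where i: "i \<in> I" "a i \<noteq> 0 \<or> b i \<noteq> 0" "c i \<noteq> 0 \<or> d i \<noteq> 0"
      using T by blast
    \<comment> \<open>The conditions survive exchanging \<open>a\<close> with \<open>b\<close> or
      \<open>c\<close> with \<open>d\<close>, so the vector and its image may both be assumed to
      have nonzero first coordinate.\<close>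
    interpret ba: matching_pair I b a c d
      using N T U H by unfold_locales (simp_all add: algebra_simps conj_commute)
    interpret dc: matching_pair I a b d c
      using N T U H by unfold_locales (simp_all add: algebra_simps conj_commute)
    interpret badc: matching_pair I b a d c
      using N T U H by unfold_locales (simp_all add: algebra_simps conj_commute)
    \<comment> \<open>Exchanging \<open>c\<close> with \<open>d\<close> replaces the scalar by its
      inverse.\<close>
    have "inverse k \<noteq> 0 \<and> inverse (inverse k) = k" if "k \<noteq> 0" for k :: 'a
      using that by simp
    then have rels: "ba.diag_rel \<Longrightarrow> swap_rel" "dc.diag_rel \<Longrightarrow> swap_rel" "badc.diag_rel \<Longrightarrow> diag_rel"
      unfolding ba.diag_rel_def dc.diag_rel_def badc.diag_rel_def diag_rel_def swap_rel_def
      by metis+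
    show ?thesis
      using i isotropic_aligned[OF i(1)] ba.isotropic_aligned[OF i(1)]
        dc.isotropic_aligned[OF i(1)] badc.isotropic_aligned[OF i(1)] iso rels
      by (metis mult.commute)
  qed
qed

end

text \<open>The sums count nonzero coordinates, but only as field elements: in characteristic 2 the
  counts 0 and 2 coincide, and the product tells them apart.\<close>

lemma T_value_eq_iff:
  fixes a b c d :: "'a::field"
  assumes "a * b = c * d"
    "(if a = 0 then 0 else 1 :: 'a) + (if b = 0 then 0 else 1) = (if c = 0 then 0 else 1) + (if d = 0 then 0 else 1)"
  shows "a = 0 \<and> b = 0 \<longleftrightarrow> c = 0 \<and> d = 0"
  using assms by (auto split: if_splits)

lemma T2_set_subset_T_set: "T2_set m \<subseteq> T_set m"
  by (auto simp: T2_set_def T_set_def)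

lemma invariants_agree_if_not_separated:
  fixes u v :: "nat \<Rightarrow> 'a::{field,finite}^2"
  assumes S: "if CARD('a) = 2 then S = T2_set m else S = T_set m"
    and uv: "\<not> separated_by S u v" and f: "f \<in> invariants m (O2_plus :: ('a^2^2) set)"
  shows "poly_eval f u = poly_eval f v"
proof -
  have eq: "poly_eval g u = poly_eval g v" if "g \<in> T2_set m" for g
    using that uv S T2_set_subset_T_set unfolding separated_by_def by (metis subsetD)
  have N: "u i $ 1 * u i $ 2 = v i $ 1 * v i $ 2" if "i \<in> {1..m}" for i
    using eq[of "N_poly i"] that by (auto simp: T2_set_def eval_generators)
  have T: "poly_eval (T_poly i) u = poly_eval (T_poly i) v" if "i \<in> {1..m}" for i
    using eq[of "T_poly i"] that by (auto simp: T2_set_def)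
  have U: "u i $ 1 * u j $ 2 + u j $ 1 * u i $ 2 = v i $ 1 * v j $ 2 + v j $ 1 * v i $ 2"
    if "i \<in> {1..m}" "j \<in> {1..m}" "i < j" for i j
    using eq[of "U_poly i j"] that by (auto simp: T2_set_def eval_generators)
  have H: "u i $ 1 * inverse (u j $ 1) + u i $ 2 * inverse (u j $ 2)
      = v i $ 1 * inverse (v j $ 1) + v i $ 2 * inverse (v j $ 2)"
    if "i \<in> {1..m}" "j \<in> {1..m}" "i < j" for i j
  proof (cases "CARD('a) = 2")
    case True
    \<comment> \<open>Over the field of two elements, \<open>x\<^sub>i x\<^sub>j + y\<^sub>i y\<^sub>j = T\<^sub>i T\<^sub>j - U\<^sub>i\<^sub>j\<close>.\<close>
    have sum: "u i $ 1 + u i $ 2 = v i $ 1 + v i $ 2" if "i \<in> {1..m}" for i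
      using T[OF that] True by (simp add: T_poly_def eval_hom.add)
    \<comment> \<open>The locale asks for ratios; over two elements these are products.\<close>
    have inv: "inverse x = x" for x :: 'a
      using power_card_minus_1[of x] True by (auto split: if_splits)
    have "u i $ 1 * u j $ 1 + u i $ 2 * u j $ 2 = v i $ 1 * v j $ 1 + v i $ 2 * v j $ 2"
      using sum[OF that(1)] sum[OF that(2)] U[OF that] by algebra
    then show ?thesis by (simp add: inv)
  next
    case False
    then have "CARD('a) > 2" using CARD_field_ge_2[where 'a='a] by simp
    moreover have "H_poly i j \<in> S"
      using that S False by (auto simp: T_set_def)
    ultimately show ?thesis
      using uv eval_H unfolding separated_by_def by metis
  qed
  interpret matching_pair "{1..m}" "\<lambda>i. u i $ 1" "\<lambda>i. u i $ 2" "\<lambda>i. v i $ 1" "\<lambda>i. v i $ 2"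
  proof
    fix i assume i: "i \<in> {1..m}"
    show "u i $ 1 * u i $ 2 = v i $ 1 * v i $ 2" using N[OF i] .
    show "u i $ 1 = 0 \<and> u i $ 2 = 0 \<longleftrightarrow> v i $ 1 = 0 \<and> v i $ 2 = 0"
      using T_value_eq_iff[OF N[OF i]] T[OF i] by (simp add: eval_T)
  next
    fix i j assume ij: "i \<in> {1..m}" "j \<in> {1..m}"
    \<comment> \<open>Given for \<open>i < j\<close>, extended by symmetry; on the diagonal it is
      twice \<open>N\<close>.\<close>
    show "u i $ 1 * u j $ 2 + u j $ 1 * u i $ 2 = v i $ 1 * v j $ 2 + v j $ 1 * v i $ 2"
      using ij N[of i] U[of i j] U[of j i]
      by (cases i j rule: linorder_cases) (simp_all add: add.commute)
  qed (fact H)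
  from same_orbit show ?thesis
  proof
    assume diag_rel
    then obtain k where k: "k \<noteq> 0"
      "\<And>i. i \<in> {1..m} \<Longrightarrow> v i $ 1 = k * u i $ 1 \<and> v i $ 2 = inverse k * u i $ 2"
      unfolding diag_rel_def by blast
    show ?thesis
    proof (rule invariant_evalI[OF f])
      \<comment> \<open>\<open>invariant_evalI\<close> moves points by the inverse matrix, hence
        \<open>inverse k\<close>; \<open>sigma_mat k\<close> below is its own inverse.\<close>
      show "tau_mat (inverse k) \<in> O2_plus" using k(1) by (auto simp: O2_plus_def)
    qed (use k in \<open>simp add: matrix_inv_tau tau_mult vec_eq_iff forall_2\<close>)
  next
    assume swap_rel
    then obtain k where k: "k \<noteq> 0"
      "\<And>i. i \<in> {1..m} \<Longrightarrow> v i $ 1 = k * u i $ 2 \<and> v i $ 2 = inverse k * u i $ 1"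
      unfolding swap_rel_def by blast
    show ?thesis
    proof (rule invariant_evalI[OF f])
      show "sigma_mat k \<in> O2_plus" using k(1) by (auto simp: O2_plus_def)
    qed (use k in \<open>simp add: matrix_inv_sigma sigma_mult vec_eq_iff forall_2\<close>)
  qed
qed

lemma separating_generators:
  assumes "if CARD('a::{field,finite}) = 2 then S = T2_set m else S = T_set m"
  shows "separating m (O2_plus :: ('a^2^2) set) S"
proof -
  have "S \<subseteq> invariants m O2_plus"
    using assms generators_invariant[where 'a='a and m=m] CARD_field_ge_2[where 'a='a]
    by (cases "CARD('a) = 2") (auto simp: T_set_def T2_set_def)
  then show ?thesis
    using invariants_agree_if_not_separated[OF assms]
    unfolding separating_def separated_by_def[of "invariants _ _"] by blast
qed

section \<open>Minimality\<close>

text \<open>If a proper subset omits \<open>f\<close>, the pair for \<open>f\<close> is still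
  separated by the invariant \<open>f\<close>, but by nothing left in the subset.\<close>

lemma minimal_separatingI:
  assumes sep: "separating m G S"
    and witness: "\<And>f. f \<in> S \<Longrightarrow> \<exists>u\<in>V_pow m. \<exists>v\<in>V_pow m.
      poly_eval f u \<noteq> poly_eval f v \<and> (\<forall>g\<in>S. g \<noteq> f \<longrightarrow> poly_eval g u = poly_eval g v)"
  shows "minimal_separating m G S"
  unfolding minimal_separating_def
proof (intro conjI allI impI notI sep)
  fix S' assume S': "S' \<subset> S" "separating m G S'"
  then obtain f where f: "f \<in> S" "f \<notin> S'" by blast
  obtain u v where uv: "u \<in> V_pow m" "v \<in> V_pow m" "poly_eval f u \<noteq> poly_eval f v"
    "\<forall>g\<in>S. g \<noteq> f \<longrightarrow> poly_eval g u = poly_eval g v"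
    using witness[OF f(1)] by blast
  have "separated_by (invariants m G) u v"
    using sep f(1) uv(3) unfolding separating_def separated_by_def by blast
  with S'(2) uv(1,2) have "separated_by S' u v"
    unfolding separating_def by blast
  then obtain g where "g \<in> S'" "poly_eval g u \<noteq> poly_eval g v"
    unfolding separated_by_def by blast
  moreover have "g \<in> S" "g \<noteq> f"
    using S'(1) f(2) \<open>g \<in> S'\<close> by auto
  ultimately show False using uv(4) by blast
qed

definition point :: "nat \<Rightarrow> (nat \<Rightarrow> 'a::zero) \<Rightarrow> (nat \<Rightarrow> 'a) \<Rightarrow> nat \<Rightarrow> 'a^2" where
  "point m a b = (\<lambda>k\<in>{1..m}. vector [a k, b k])"

lemma point_in_V_pow: "point m a b \<in> V_pow m"
  by (simp add: V_pow_def point_def)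

lemma point_nth:
  assumes "1 \<le> k" "k \<le> m"
  shows "point m a b k $ 1 = a k" "point m a b k $ 2 = b k"
  using assms by (simp_all add: point_def)

lemma witnessI:
  assumes "poly_eval f (point m a b) \<noteq> poly_eval f (point m c d)"
    and "\<And>g. g \<in> S \<Longrightarrow> g \<noteq> f \<Longrightarrow> poly_eval g (point m a b) = poly_eval g (point m c d)"
  shows "\<exists>u\<in>V_pow m. \<exists>v\<in>V_pow m.
      poly_eval f u \<noteq> poly_eval f v \<and> (\<forall>g\<in>S. g \<noteq> f \<longrightarrow> poly_eval g u = poly_eval g v)"
  using assms by (intro bexI[of _ "point m a b"] bexI[of _ "point m c d"] point_in_V_pow) blast

text \<open>Both bounds are spelled out for each index, as \<open>point_nth\<close> requires
  them.\<close>

lemma T2_set_cases [consumes 1, case_names N T U]: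
  assumes "g \<in> T2_set m"
  obtains i where "g = N_poly i" "1 \<le> i" "i \<le> m"
  | i where "g = T_poly i" "1 \<le> i" "i \<le> m"
  | i j where "g = U_poly i j" "1 \<le> i" "i \<le> m" "1 \<le> j" "j \<le> m" "i < j"
proof -
  have "(\<exists>i. g = N_poly i \<and> 1 \<le> i \<and> i \<le> m) \<or> (\<exists>i. g = T_poly i \<and> 1 \<le> i \<and> i \<le> m)
    \<or> (\<exists>i j. g = U_poly i j \<and> 1 \<le> i \<and> i < j \<and> j \<le> m)"
    using assms unfolding T2_set_def by blast
  then show ?thesis
    using that by (elim disjE exE conjE) simp_all
qed

lemma T_set_cases [consumes 1, case_names N T U H]:
  assumes "g \<in> T_set m"
  obtains i where "g = N_poly i" "1 \<le> i" "i \<le> m"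
  | i where "g = T_poly i" "1 \<le> i" "i \<le> m"
  | i j where "g = U_poly i j" "1 \<le> i" "i \<le> m" "1 \<le> j" "j \<le> m" "i < j"
  | i j where "g = H_poly i j" "1 \<le> i" "i \<le> m" "1 \<le> j" "j \<le> m" "i < j"
proof -
  have "(\<exists>i. g = N_poly i \<and> 1 \<le> i \<and> i \<le> m) \<or> (\<exists>i. g = T_poly i \<and> 1 \<le> i \<and> i \<le> m)
    \<or> (\<exists>i j. g = U_poly i j \<and> 1 \<le> i \<and> i < j \<and> j \<le> m)
    \<or> (\<exists>i j. g = H_poly i j \<and> 1 \<le> i \<and> i < j \<and> j \<le> m)"
    using assms unfolding T_set_def by blast
  then show ?thesis
    using that by (elim disjE exE conjE) simp_all
qed

lemma obtain_third_element:
  assumes "CARD('a) > 2"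
  obtains c :: "'a::{field,finite}" where "c \<noteq> 0" "c \<noteq> 1"
proof -
  have "\<not> (UNIV :: 'a set) \<subseteq> {0, 1}"
    using assms card_mono[of "{0, 1 :: 'a}" UNIV] by auto
  then show ?thesis using that by blast
qed

lemma minimal_T2_set:
  assumes q: "CARD('a::{field,finite}) = 2"
  shows "minimal_separating m (O2_plus :: ('a^2^2) set) (T2_set m)"
proof (rule minimal_separatingI)
  show "separating m (O2_plus :: ('a^2^2) set) (T2_set m)"
    using q by (intro separating_generators) simp
next
  have two: "(1 :: 'a) + 1 = 0"
  proof -
    have "{0, 1 :: 'a} = UNIV"
      using q by (intro card_subset_eq) simp_all
    then have "(1 :: 'a) + 1 = 0 \<or> (1 :: 'a) + 1 = 1 + 0" by auto
    then show ?thesis by (simp only: add_left_cancel one_neq_zero simp_thms)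
  qed
  fix f :: "'a mpoly" assume "f \<in> T2_set m"
  then show "\<exists>u\<in>V_pow m. \<exists>v\<in>V_pow m. poly_eval f u \<noteq> poly_eval f v
    \<and> (\<forall>g\<in>T2_set m. g \<noteq> f \<longrightarrow> poly_eval g u = poly_eval g v)"
  proof (cases rule: T2_set_cases)
    case f: (N i)
    show ?thesis
    \<comment> \<open>The vector (1,1) against 0: \<open>T\<close> is 1 + 1 = 0 on both, and
      \<open>U\<close> vanishes because all other vectors are 0.\<close>
    proof (rule witnessI[of _ _ "\<lambda>k. if k = i then 1 else 0" "\<lambda>k. if k = i then 1 else 0" "\<lambda>k. 0" "\<lambda>k. 0"])
      fix g assume "g \<in> T2_set m" "g \<noteq> f"
      then show "poly_eval g (point m (\<lambda>k. if k = i then 1 else 0) (\<lambda>k. if k = i then 1 else 0))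
          = poly_eval g (point m (\<lambda>k. 0) (\<lambda>k. 0))"
        by (cases rule: T2_set_cases) (use f two in \<open>auto simp: eval_generators eval_T point_nth\<close>)
    qed (use f two in \<open>simp add: eval_generators eval_T point_nth\<close>)
  next
    case f: (T i)
    show ?thesis
    proof (rule witnessI[of _ _ "\<lambda>k. if k = i then 1 else 0" "\<lambda>k. 0" "\<lambda>k. 0" "\<lambda>k. 0"])
      fix g assume "g \<in> T2_set m" "g \<noteq> f"
      then show "poly_eval g (point m (\<lambda>k. if k = i then 1 else 0) (\<lambda>k. 0))
          = poly_eval g (point m (\<lambda>k. 0) (\<lambda>k. 0))"
        by (cases rule: T2_set_cases) (use f in \<open>auto simp: eval_generators eval_T point_nth\<close>)
    qed (use f in \<open>simp add: eval_generators eval_T point_nth\<close>)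
  next
    case f: (U i j)
    show ?thesis
    \<comment> \<open>Two unit vectors on the same axis against different axes; \<open>N\<close> and
      \<open>T\<close> see each vector separately and cannot tell.\<close>
    proof (rule witnessI[of _ _ "\<lambda>k. if k = i \<or> k = j then 1 else 0" "\<lambda>k. 0" "\<lambda>k. if k = i then 1 else 0" "\<lambda>k. if k = j then 1 else 0"])
      fix g assume "g \<in> T2_set m" "g \<noteq> f"
      then show "poly_eval g (point m (\<lambda>k. if k = i \<or> k = j then 1 else 0) (\<lambda>k. 0))
          = poly_eval g (point m (\<lambda>k. if k = i then 1 else 0) (\<lambda>k. if k = j then 1 else 0))"
        by (cases rule: T2_set_cases) (use f in \<open>auto simp: eval_generators eval_T point_nth\<close>)
    qed (use f in \<open>simp add: eval_generators eval_T point_nth\<close>)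
  qed
qed

lemma minimal_T_set:
  assumes q: "CARD('a::{field,finite}) > 2"
  shows "minimal_separating m (O2_plus :: ('a^2^2) set) (T_set m)"
proof (rule minimal_separatingI)
  show "separating m (O2_plus :: ('a^2^2) set) (T_set m)"
    using q by (intro separating_generators) simp
next
  obtain c :: 'a where c: "c \<noteq> 0" "c \<noteq> 1"
    using q by (rule obtain_third_element)
  fix f :: "'a mpoly" assume "f \<in> T_set m"
  then show "\<exists>u\<in>V_pow m. \<exists>v\<in>V_pow m. poly_eval f u \<noteq> poly_eval f v
    \<and> (\<forall>g\<in>T_set m. g \<noteq> f \<longrightarrow> poly_eval g u = poly_eval g v)"
  proof (cases rule: T_set_cases)
    case f: (N i)
    show ?thesis
    \<comment> \<open>The vector (1,1) against (1,c): no coordinate becomes 0, so \<open>T\<close>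
      is unchanged; \<open>U\<close> and \<open>H\<close> vanish since all other vectors are
      0.\<close>
    proof (rule witnessI[of _ _ "\<lambda>k. if k = i then 1 else 0" "\<lambda>k. if k = i then 1 else 0" "\<lambda>k. if k = i then 1 else 0" "\<lambda>k. if k = i then c else 0"])
      fix g assume "g \<in> T_set m" "g \<noteq> f"
      then show "poly_eval g (point m (\<lambda>k. if k = i then 1 else 0) (\<lambda>k. if k = i then 1 else 0))
          = poly_eval g (point m (\<lambda>k. if k = i then 1 else 0) (\<lambda>k. if k = i then c else 0))"
        by (cases rule: T_set_cases) (use f c in \<open>auto simp: eval_generators eval_T eval_H[OF q] point_nth\<close>)
    qed (use f c in \<open>simp add: eval_generators eval_T eval_H[OF q] point_nth\<close>)
  next
    case f: (T i)
    show ?thesis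
    proof (rule witnessI[of _ _ "\<lambda>k. if k = i then 1 else 0" "\<lambda>k. 0" "\<lambda>k. 0" "\<lambda>k. 0"])
      fix g assume "g \<in> T_set m" "g \<noteq> f"
      then show "poly_eval g (point m (\<lambda>k. if k = i then 1 else 0) (\<lambda>k. 0))
          = poly_eval g (point m (\<lambda>k. 0) (\<lambda>k. 0))"
        by (cases rule: T_set_cases) (use f in \<open>auto simp: eval_generators eval_T eval_H[OF q] point_nth\<close>)
    qed (use f in \<open>simp add: eval_generators eval_T eval_H[OF q] point_nth\<close>)
  next
    case f: (U i j)
    show ?thesis
    \<comment> \<open>Changing the axis, as for q = 2, would alter \<open>H_poly i j\<close> too.
      Instead the vectors stay on different axes, where \<open>H\<close> is 0, and the second is
      scaled by \<open>c\<close>.\<close>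
    proof (rule witnessI[of _ _ "\<lambda>k. if k = i then 1 else 0" "\<lambda>k. if k = j then 1 else 0" "\<lambda>k. if k = i then 1 else 0" "\<lambda>k. if k = j then c else 0"])
      fix g assume "g \<in> T_set m" "g \<noteq> f"
      then show "poly_eval g (point m (\<lambda>k. if k = i then 1 else 0) (\<lambda>k. if k = j then 1 else 0))
          = poly_eval g (point m (\<lambda>k. if k = i then 1 else 0) (\<lambda>k. if k = j then c else 0))"
        by (cases rule: T_set_cases) (use f c in \<open>auto simp: eval_generators eval_T eval_H[OF q] point_nth\<close>)
    qed (use f c in \<open>simp add: eval_generators eval_T eval_H[OF q] point_nth\<close>)
  next
    case f: (H i j)
    show ?thesis
    \<comment> \<open>On a common axis \<open>U\<close> is 0, and scaling the second vector by
      \<open>c\<close> changes the ratio from 1 to \<open>inverse c\<close>.\<close>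
    proof (rule witnessI[of _ _ "\<lambda>k. if k = i \<or> k = j then 1 else 0" "\<lambda>k. 0"
        "\<lambda>k. if k = i then 1 else if k = j then c else 0" "\<lambda>k. 0"])
      fix g assume "g \<in> T_set m" "g \<noteq> f"
      then show "poly_eval g (point m (\<lambda>k. if k = i \<or> k = j then 1 else 0) (\<lambda>k. 0))
          = poly_eval g (point m (\<lambda>k. if k = i then 1 else if k = j then c else 0) (\<lambda>k. 0))"
        by (cases rule: T_set_cases) (use f c in \<open>auto simp: eval_generators eval_T eval_H[OF q] point_nth\<close>)
    qed (use f c in \<open>simp add: eval_generators eval_T eval_H[OF q] point_nth\<close>)
  qed
qed

theorem theorem3p4:
  fixes m :: nat
  assumes "m > 0"
  shows "(CARD('a::{field,finite}) = 2 \<longrightarrow>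
            minimal_separating m (O2_plus :: ('a^2^2) set) (T2_set m)) \<and>
         (CARD('a) > 2 \<longrightarrow>
            minimal_separating m (O2_plus :: ('a^2^2) set) (T_set m))"
  using minimal_T2_set minimal_T_set by blast

end
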